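(* Let $Z$ and $X$ be Banach spaces. Suppose that $X$ is Asplund. Let $\mathcal{M}$ be a bounded subset of $\mathcal{L}(Z,X)$ having the Rainwater property. Let $(z_n)_{n\in\mathbb{N}}$ be a sequence in $Z$ such that: (a) for each $n\in\mathbb{N}$, the set $\{M(z_n): M\in\mathcal{M}\}$ is relatively norm compact; (b) for each sequence $(M_n)_{n\in\mathbb{N}}$ in $\mathcal{M}$, the series $\sum_{n=1}^\infty M_n(z_n)$ is weakly unconditionally Cauchy. Let $T\in\mathcal{M}$ be such that: (c) $T$ is Dunford-Pettis; (d) $z_n\neq 0$ for all $n\in\mathbb{N}$ and $\inf_{n\in\mathbb{N}}\|T(z_n)\|\,\|z_n\|^{-1}>0$. Then the series $\sum_{n=1}^\infty T(z_n)$ is absolutely convergent, i.e. $\sum_{n=1}^\infty\|T(z_n)\|<\infty$.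
   Context: All Banach spaces are real. An operator is a continuous linear map between Banach spaces; $\mathcal{L}(Z,X)$ is the Banach space of all operators from $Z$ to $X$ with the operator norm. A set $\mathcal{M}\subseteq\mathcal{L}(Z,X)$ has the Rainwater property if: a bounded sequence $(z_n)_{n\in\mathbb{N}}$ in $Z$ is weakly null whenever, for each $M\in\mathcal{M}$, the sequence $(M(z_n))_{n\in\mathbb{N}}$ is weakly null in $X$. A Banach space is Asplund if each of its separable closed linear subspaces has separable dual. An operator is Dunford-Pettis if it maps weakly null sequences to norm null sequences. A series $\sum_n x_n$ in a Banach space $X$ is weakly unconditionally Cauchy if $\sum_n|x^*(x_n)|<\infty$ for every $x^*\in X^*$. *)

theory Defs
  imports "HOL-Analysis.Analysis"
begin

definition weakly_null :: "(nat \<Rightarrow> 'a::real_normed_vector) \<Rightarrow> bool" where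
  "weakly_null x \<longleftrightarrow> (\<forall>f :: 'a \<Rightarrow>\<^sub>L real. (\<lambda>n. blinfun_apply f (x n)) \<longlonglongrightarrow> 0)"

definition weakly_unconditionally_Cauchy :: "(nat \<Rightarrow> 'a::real_normed_vector) \<Rightarrow> bool" where
  "weakly_unconditionally_Cauchy x \<longleftrightarrow>
     (\<forall>f :: 'a \<Rightarrow>\<^sub>L real. summable (\<lambda>n. \<bar>blinfun_apply f (x n)\<bar>))"

definition Dunford_Pettis :: "('z::real_normed_vector \<Rightarrow>\<^sub>L 'x::real_normed_vector) \<Rightarrow> bool" where
  "Dunford_Pettis T \<longleftrightarrow> (\<forall>z. weakly_null z \<longrightarrow> (\<lambda>n. blinfun_apply T (z n)) \<longlonglongrightarrow> 0)"

definition Rainwater_property ::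
    "('z::real_normed_vector \<Rightarrow>\<^sub>L 'x::real_normed_vector) set \<Rightarrow> bool" where
  "Rainwater_property \<M> \<longleftrightarrow>
     (\<forall>z. bounded (range z) \<longrightarrow> (\<forall>M\<in>\<M>. weakly_null (\<lambda>n. blinfun_apply M (z n)))
        \<longrightarrow> weakly_null z)"

text \<open>
  A subspace \<open>Y\<close> of \<open>'a\<close> is a set and not a type, so its dual cannot be written as a type of
  bounded linear functions. An element of the dual of \<open>Y\<close> is represented by a function on the
  whole type that is \<open>undefined\<close> off \<open>Y\<close>, which makes the representation unique.
\<close>

definition subspace_dual :: "'a::real_normed_vector set \<Rightarrow> ('a \<Rightarrow> real) set" where
  "subspace_dual Y =
     {f \<in> extensional Y.
        (\<forall>x\<in>Y. \<forall>y\<in>Y. f (x + y) = f x + f y) \<and>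
        (\<forall>c. \<forall>x\<in>Y. f (c *\<^sub>R x) = c * f x) \<and>
        (\<exists>K. \<forall>x\<in>Y. \<bar>f x\<bar> \<le> K * norm x)}"

text \<open>
  The metric of the dual norm, the supremum over the closed unit ball of \<open>Y\<close>. The value off the
  dual is irrelevant; it is \<open>0\<close> because the locale \<open>Metric_space\<close> asks for
  nonnegativity and symmetry everywhere.
\<close>

definition subspace_dual_dist ::
    "'a::real_normed_vector set \<Rightarrow> ('a \<Rightarrow> real) \<Rightarrow> ('a \<Rightarrow> real) \<Rightarrow> real" where
  "subspace_dual_dist Y f g =
     (if f \<in> subspace_dual Y \<and> g \<in> subspace_dual Y
      then SUP y\<in>Y \<inter> cball 0 1. \<bar>f y - g y\<bar> else 0)"

lemma subspace_dual_bdd_above: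
  assumes "f \<in> subspace_dual Y" "g \<in> subspace_dual Y"
  shows "bdd_above ((\<lambda>y. \<bar>f y - g y\<bar>) ` (Y \<inter> cball 0 1))"
proof -
  obtain K where K: "\<And>x. x \<in> Y \<Longrightarrow> \<bar>f x\<bar> \<le> K * norm x"
    using assms(1) unfolding subspace_dual_def by blast
  obtain L where L: "\<And>x. x \<in> Y \<Longrightarrow> \<bar>g x\<bar> \<le> L * norm x"
    using assms(2) unfolding subspace_dual_def by blast
  have "\<bar>f y - g y\<bar> \<le> \<bar>K\<bar> + \<bar>L\<bar>" if "y \<in> Y \<inter> cball 0 1" for y
  proof -
    have y: "y \<in> Y" "norm y \<le> 1" using that by auto
    have "\<bar>f y\<bar> \<le> \<bar>K\<bar> * norm y"
      using K[OF y(1)] by (meson abs_ge_self mult_right_mono norm_ge_zero order_trans)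
    moreover have "\<bar>g y\<bar> \<le> \<bar>L\<bar> * norm y"
      using L[OF y(1)] by (meson abs_ge_self mult_right_mono norm_ge_zero order_trans)
    moreover have "\<bar>K\<bar> * norm y \<le> \<bar>K\<bar>" "\<bar>L\<bar> * norm y \<le> \<bar>L\<bar>"
      using y(2) by (simp_all add: mult_left_le)
    ultimately show ?thesis by linarith
  qed
  then show ?thesis by (rule bdd_aboveI2)
qed

lemma subspace_dual_dist_upper:
  assumes "f \<in> subspace_dual Y" "g \<in> subspace_dual Y" "y \<in> Y" "norm y \<le> 1"
  shows "\<bar>f y - g y\<bar> \<le> subspace_dual_dist Y f g"
  using assms cSUP_upper[OF _ subspace_dual_bdd_above[OF assms(1,2)], of y]
  by (simp add: subspace_dual_dist_def)

lemma subspace_dual_dist_least: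
  assumes "subspace Y" "f \<in> subspace_dual Y" "g \<in> subspace_dual Y"
    and "\<And>y. y \<in> Y \<Longrightarrow> norm y \<le> 1 \<Longrightarrow> \<bar>f y - g y\<bar> \<le> B"
  shows "subspace_dual_dist Y f g \<le> B"
proof -
  have "0 \<in> Y \<inter> cball 0 1" using subspace_0[OF assms(1)] by simp
  then have "(SUP y\<in>Y \<inter> cball 0 1. \<bar>f y - g y\<bar>) \<le> B"
    using assms(4) by (intro cSUP_least) auto
  then show ?thesis using assms(2,3) by (simp add: subspace_dual_dist_def)
qed

lemma Metric_space_subspace_dual:
  assumes Y: "subspace Y"
  shows "Metric_space (subspace_dual Y) (subspace_dual_dist Y)"
proof
  fix f g :: "'a \<Rightarrow> real"
  show "0 \<le> subspace_dual_dist Y f g"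
  proof (cases "f \<in> subspace_dual Y \<and> g \<in> subspace_dual Y")
    case True
    then have "\<bar>f 0 - g 0\<bar> \<le> subspace_dual_dist Y f g"
      using subspace_0[OF Y] by (intro subspace_dual_dist_upper) auto
    then show ?thesis by linarith
  qed (auto simp: subspace_dual_dist_def)
  show "subspace_dual_dist Y f g = subspace_dual_dist Y g f"
    by (auto simp: subspace_dual_dist_def abs_minus_commute)
next
  fix f g assume fg: "f \<in> subspace_dual Y" "g \<in> subspace_dual Y"
  show "subspace_dual_dist Y f g = 0 \<longleftrightarrow> f = g"
  proof
    assume 0: "subspace_dual_dist Y f g = 0"
    show "f = g"
    proof (rule extensionalityI[of _ Y])
      show "f \<in> extensional Y" "g \<in> extensional Y"
        using fg by (auto simp: subspace_dual_def)
      fix y assume y: "y \<in> Y"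
      define c where "c = inverse (norm y + 1)"
      have c: "c > 0" unfolding c_def by (simp add: add_nonneg_pos)
      have "norm (c *\<^sub>R y) \<le> 1" unfolding c_def
        using add_nonneg_pos[OF norm_ge_zero[of y] zero_less_one]
        by (simp add: divide_le_eq_1 divide_inverse_commute[symmetric])
      then have "\<bar>f (c *\<^sub>R y) - g (c *\<^sub>R y)\<bar> \<le> 0"
        using subspace_dual_dist_upper[OF fg] subspace_scale[OF Y y] 0 by metis
      moreover have "f (c *\<^sub>R y) = c * f y" "g (c *\<^sub>R y) = c * g y"
        using fg y by (auto simp: subspace_dual_def)
      ultimately show "f y = g y" using c by simp
    qed
  next
    assume "f = g"
    moreover have "0 \<in> Y \<inter> cball 0 1" using subspace_0[OF Y] by simp
    then have "Y \<inter> cball 0 1 \<noteq> {}" by blast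
    ultimately show "subspace_dual_dist Y f g = 0"
      by (simp add: subspace_dual_dist_def)
  qed
next
  fix f g h
  assume fgh: "f \<in> subspace_dual Y" "g \<in> subspace_dual Y" "h \<in> subspace_dual Y"
  show "subspace_dual_dist Y f h \<le> subspace_dual_dist Y f g + subspace_dual_dist Y g h"
  proof (rule subspace_dual_dist_least[OF Y fgh(1,3)])
    fix y assume y: "y \<in> Y" "norm y \<le> 1"
    show "\<bar>f y - h y\<bar> \<le> subspace_dual_dist Y f g + subspace_dual_dist Y g h"
      using subspace_dual_dist_upper[OF fgh(1,2) y] subspace_dual_dist_upper[OF fgh(2,3) y]
      by linarith
  qed
qed

definition Asplund_space :: "'a::banach itself \<Rightarrow> bool" where
  "Asplund_space TYPE('a) \<longleftrightarrow>
     (\<forall>Y :: 'a set. subspace Y \<longrightarrow> closed Y \<longrightarrow> separable_space (top_of_set Y) \<longrightarrow>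
        separable_space (Metric_space.mtopology (subspace_dual Y) (subspace_dual_dist Y)))"

end

theory Submission
  imports Defs
begin

text \<open>
  As \<open>T\<close> is bounded, it is enough that \<open>\<Sum>\<^sub>n \<parallel>z\<^sub>n\<parallel> < \<infinity>\<close>. Suppose that this fails, and let \<open>u\<^sub>n\<close> be
  the unit vector in the direction of \<open>z\<^sub>n\<close>. The contradiction comes from a choice of indices along
  which the \<open>u\<^sub>n\<close> are weakly null: \<open>T\<close>, being Dunford-Pettis, would send them to a norm null
  sequence, while \<open>\<parallel>T u\<^sub>n\<parallel>\<close> is bounded away from \<open>0\<close>.

  By the Rainwater property it suffices that \<open>M u\<^sub>n\<close> is weakly null along the chosen indices for
  every \<open>M \<in> \<M>\<close>. For finitely many functionals at a time, the divergence of \<open>\<Sum>\<^sub>n \<parallel>z\<^sub>n\<parallel>\<close>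
  yields an index that makes them small on all \<open>M u\<^sub>n\<close>, \<open>M \<in> \<M>\<close>:
  if at every index some functional of the finite set and some operator \<open>M\<^sub>n \<in> \<M>\<close> had a value of
  size at least \<open>e\<close> on \<open>u\<^sub>n\<close>, then \<open>e \<parallel>z\<^sub>n\<parallel>\<close> would be dominated by the values of finitely many
  functionals on \<open>M\<^sub>n z\<^sub>n\<close>, and these are absolutely summable because \<open>\<Sum>\<^sub>n M\<^sub>n z\<^sub>n\<close> is weakly
  unconditionally Cauchy (\<open>uniformly_small_normalized_term\<close>). A diagonal choice then handles
  countably many functionals.

  Countably many functionals are enough because \<open>X\<close> is Asplund: by compactness all vectors
  \<open>M z\<^sub>n\<close> lie in one separable closed subspace, the dual of which is separable, so a countable
  family of functionals is dense, uniformly on the unit ball of the subspace, among the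
  restrictions of all functionals (\<open>Asplund_countable_functionals\<close>).
\<close>

lemma compact_imp_countable_dense_subset:
  fixes K :: "'a::metric_space set"
  assumes "compact K"
  obtains C where "countable C" "C \<subseteq> K" "K \<subseteq> closure C"
proof -
  have "\<forall>e>0. \<exists>F. finite F \<and> F \<subseteq> K \<and> K \<subseteq> (\<Union>x\<in>F. ball x e)"
    using assms seq_compact_imp_totally_bounded compact_eq_seq_compact_metric by blast
  then have "\<forall>j. \<exists>F. finite F \<and> F \<subseteq> K \<and> K \<subseteq> (\<Union>x\<in>F. ball x (inverse (real (Suc j))))"
    by simp
  then obtain F where F: "\<And>j. finite (F j)" "\<And>j. F j \<subseteq> K"
      "\<And>j. K \<subseteq> (\<Union>x\<in>F j. ball x (inverse (real (Suc j))))"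
    by metis
  have "x \<in> closure (\<Union>j. F j)" if x: "x \<in> K" for x
    unfolding closure_approachable
  proof (intro allI impI)
    fix e :: real assume "e > 0"
    then obtain j where j: "inverse (real (Suc j)) < e"
      using reals_Archimedean by blast
    obtain y where "y \<in> F j" "dist y x < inverse (real (Suc j))"
      using F(3)[of j] x by (auto simp: dist_commute)
    then show "\<exists>y\<in>\<Union>j. F j. dist y x < e"
      using j by (meson UN_I UNIV_I less_trans)
  qed
  moreover have "countable (\<Union>j. F j)" using F(1) by (simp add: countable_finite)
  ultimately show thesis using that[of "\<Union>j. F j"] F(2) by blast
qed

text \<open>
  The finite rational linear combinations of a countable set form a countable set whose closure
  is already a real subspace, because real scalars are limits of rational ones.
\<close>

lemma separable_closed_subspace_containing_countable:
  fixes S :: "'a::real_normed_vector set"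
  assumes "countable S"
  obtains Y where "subspace Y" "closed Y" "separable_space (top_of_set Y)" "S \<subseteq> Y"
proof -
  define comb where "comb xs = (\<Sum>(q, s)\<leftarrow>xs. (of_rat q :: real) *\<^sub>R s)" for xs :: "(rat \<times> 'a) list"
  define Q where "Q = comb ` lists (UNIV \<times> S)"
  have Q_countable: "countable Q"
    unfolding Q_def using assms by (intro countable_image countable_lists countable_SIGMA) auto
  have Q_0: "0 \<in> Q"
    unfolding Q_def by (rule image_eqI[of _ _ "[]"]) (auto simp: comb_def)
  have Q_add: "x + y \<in> Q" if xy: "x \<in> Q" "y \<in> Q" for x y
  proof -
    obtain xs ys where "x = comb xs" "xs \<in> lists (UNIV \<times> S)" "y = comb ys" "ys \<in> lists (UNIV \<times> S)"
      using xy unfolding Q_def by blast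
    then show ?thesis
      unfolding Q_def by (intro image_eqI[of _ _ "xs @ ys"]) (auto simp: comb_def)
  qed
  have Q_scale: "of_rat q *\<^sub>R x \<in> Q" if x: "x \<in> Q" for q x
  proof -
    obtain xs where xs: "x = comb xs" "xs \<in> lists (UNIV \<times> S)"
      using x unfolding Q_def by blast
    have "comb (map (\<lambda>(p, s). (q * p, s)) xs) = of_rat q *\<^sub>R comb xs"
      by (induction xs) (auto simp: comb_def of_rat_mult scaleR_add_right)
    moreover have "map (\<lambda>(p, s). (q * p, s)) xs \<in> lists (UNIV \<times> S)"
      using xs(2) by (induction xs) auto
    ultimately show ?thesis using xs(1) unfolding Q_def by (metis image_eqI)
  qed
  have Q_S: "s \<in> Q" if "s \<in> S" for s
    unfolding Q_def using that by (intro image_eqI[of _ _ "[(1, s)]"]) (auto simp: comb_def)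
  have "subspace (closure Q)"
    unfolding subspace_def
  proof (intro conjI allI ballI)
    show "0 \<in> closure Q" using Q_0 closure_subset by blast
  next
    fix x y assume "x \<in> closure Q" "y \<in> closure Q"
    then obtain f g where "\<And>n. f n \<in> Q" "f \<longlonglongrightarrow> x" "\<And>n. g n \<in> Q" "g \<longlonglongrightarrow> y"
      unfolding closure_sequential by blast
    then show "x + y \<in> closure Q"
      unfolding closure_sequential using Q_add by (intro exI[of _ "\<lambda>n. f n + g n"]) (auto intro: tendsto_add)
  next
    fix c :: real and x assume "x \<in> closure Q"
    then obtain f where f: "\<And>n. f n \<in> Q" "f \<longlonglongrightarrow> x"
      unfolding closure_sequential by blast
    have "\<exists>q. c < of_rat q \<and> of_rat q < c + inverse (real (Suc n))" for n
      by (rule of_rat_dense) simp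
    then obtain r :: "nat \<Rightarrow> rat" where
      r: "\<And>n. c < of_rat (r n)" "\<And>n. of_rat (r n) < c + inverse (real (Suc n))"
      by metis
    have "(\<lambda>n. c + inverse (real (Suc n))) \<longlonglongrightarrow> c + 0"
      by (intro tendsto_add tendsto_const LIMSEQ_inverse_real_of_nat)
    then have "(\<lambda>n. c + inverse (real (Suc n))) \<longlonglongrightarrow> c" by simp
    then have r_lim: "(\<lambda>n. of_rat (r n)) \<longlonglongrightarrow> c"
      by (rule tendsto_sandwich[OF _ _ tendsto_const, rotated -1])
        (use r less_imp_le in \<open>blast intro: always_eventually\<close>)+
    then show "c *\<^sub>R x \<in> closure Q"
      unfolding closure_sequential using f(1) Q_scale tendsto_scaleR[OF r_lim f(2)]
      by (intro exI[of _ "\<lambda>n. of_rat (r n) *\<^sub>R f n"]) simp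
  qed
  moreover have "separable_space (top_of_set (closure Q))"
    unfolding separable_space_def
    using Q_countable closure_subset[of Q]
    by (intro exI[of _ Q]) (auto simp: closure_of_subtopology Int_absorb1)
  ultimately show thesis
    using that[of "closure Q"] Q_S closure_subset by blast
qed

text \<open>
  The dual of a separable closed subspace around \<open>S\<close> is separable, and separability passes to
  the set of restrictions to this subspace of functionals on the whole space.
\<close>

lemma Asplund_countable_functionals:
  fixes S :: "'x::banach set"
  assumes "Asplund_space TYPE('x)" "countable S"
  obtains d :: "nat \<Rightarrow> 'x \<Rightarrow>\<^sub>L real" where
    "\<And>(f :: 'x \<Rightarrow>\<^sub>L real) e. e > 0 \<Longrightarrow> \<exists>i. \<forall>y\<in>closure S. \<bar>f y - d i y\<bar> \<le> e * norm y"
proof -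
  obtain Y where Y: "subspace Y" "closed Y" "separable_space (top_of_set Y)" "S \<subseteq> Y"
    using separable_closed_subspace_containing_countable[OF assms(2)] by blast
  interpret Ystar: Metric_space "subspace_dual Y" "subspace_dual_dist Y"
    by (rule Metric_space_subspace_dual[OF Y(1)])
  have "separable_space Ystar.mtopology"
    using assms(1) Y unfolding Asplund_space_def by blast
  then obtain C where C: "countable C" "C \<subseteq> subspace_dual Y"
      "Ystar.mtopology closure_of C = subspace_dual Y"
    unfolding separable_space_def by auto
  define res where "res f = restrict (blinfun_apply f) Y" for f :: "'x \<Rightarrow>\<^sub>L real"
  have res: "res f \<in> subspace_dual Y" for f
  proof -
    have "\<exists>K. \<forall>x\<in>Y. \<bar>blinfun_apply f x\<bar> \<le> K * norm x"
      using norm_blinfun[of f] by (intro exI[of _ "norm f"]) auto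
    then show ?thesis
      using Y(1) unfolding subspace_dual_def res_def
      by (auto simp: subspace_add subspace_scale blinfun.add_right blinfun.scaleR_right)
  qed
  \<comment> \<open>The points of \<open>C\<close> need not be restrictions of functionals on the whole space, so each ball
    around a point of \<open>C\<close> that contains a restriction contributes one.\<close>
  define pick where
    "pick p = (SOME g. subspace_dual_dist Y (res g) (fst p) < inverse (real (Suc (snd p))))"
    for p :: "('x \<Rightarrow> real) \<times> nat"
  define D where "D = pick ` (C \<times> UNIV)"
  have D: "countable D" unfolding D_def using C(1) by auto
  show thesis
  proof (rule that[of "from_nat_into D"])
    fix f :: "'x \<Rightarrow>\<^sub>L real" and e :: real
    assume e: "e > 0"
    then obtain j where j: "inverse (real (Suc j)) < e / 2"
      using reals_Archimedean[of "e / 2"] by auto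
    have "res f \<in> Ystar.mtopology closure_of C" using res C(3) by simp
    then obtain c where c: "c \<in> C" "subspace_dual_dist Y (res f) c < inverse (real (Suc j))"
      unfolding Ystar.metric_closure_of by (auto dest!: spec[of _ "inverse (real (Suc j))"])
    define g where "g = pick (c, j)"
    have "subspace_dual_dist Y (res g) c < inverse (real (Suc j))"
      unfolding g_def pick_def fst_conv snd_conv
      by (rule someI[of _ f]) (rule c(2))
    then have fg: "subspace_dual_dist Y (res f) (res g) < e"
      using Ystar.triangle[OF res[of f] _ res[of g], of c] c C(2) j Ystar.commute[of c "res g"]
      by (smt (verit) field_sum_of_halves subsetD)
    have "\<bar>f y - g y\<bar> \<le> e * norm y" if y: "y \<in> Y" for y
    proof (cases "y = 0")
      case False
      define w where "w = (inverse (norm y)) *\<^sub>R y"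
      have w: "w \<in> Y" "norm w \<le> 1"
        using y Y(1) False by (auto simp: w_def subspace_scale)
      have "\<bar>f w - g w\<bar> \<le> e"
        using subspace_dual_dist_upper[OF res[of f] res[of g] w] fg w by (simp add: res_def)
      moreover have "f w - g w = inverse (norm y) * (f y - g y)"
        by (simp add: w_def blinfun.scaleR_right algebra_simps)
      ultimately show ?thesis
        using False by (simp add: abs_mult field_simps)
    qed (simp add: blinfun.zero_right)
    moreover have "g \<in> D" unfolding D_def g_def using c(1) by auto
    moreover have "closure S \<subseteq> Y" using Y(2,4) by (rule closure_minimal[rotated])
    moreover obtain i where i: "from_nat_into D i = g"
      using from_nat_into_surj[OF D \<open>g \<in> D\<close>] by blast
    ultimately show "\<exists>i. \<forall>y\<in>closure S. \<bar>f y - from_nat_into D i y\<bar> \<le> e * norm y"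
      by (intro exI[of _ i]) auto
  qed
qed

text \<open>
  If every index admitted a large value, the choice of one operator per index would be a single
  sequence to which the weakly unconditionally Cauchy condition applies, and the finitely many
  resulting scalar series would dominate \<open>\<Sum>\<^sub>n \<parallel>z\<^sub>n\<parallel>\<close>. Letting the operator depend on the index
  is what gives an index that is good for all of \<open>\<M>\<close> simultaneously.
\<close>

lemma uniformly_small_normalized_term:
  fixes \<M> :: "('z::real_normed_vector \<Rightarrow>\<^sub>L 'x::real_normed_vector) set"
    and F :: "('x \<Rightarrow>\<^sub>L real) set"
  assumes wuC: "\<And>Ms. (\<And>n. Ms n \<in> \<M>) \<Longrightarrow>
           weakly_unconditionally_Cauchy (\<lambda>n. blinfun_apply (Ms n) (z n))"
    and not_summable: "\<not> summable (\<lambda>n. norm (z n))"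
    and F: "finite F" and e: "e > 0"
  obtains n where "\<And>d M. d \<in> F \<Longrightarrow> M \<in> \<M> \<Longrightarrow> \<bar>d (M (sgn (z n)))\<bar> < e"
proof (rule ccontr)
  assume "\<not> thesis"
  then have "\<forall>n. \<exists>d M. d \<in> F \<and> M \<in> \<M> \<and> e \<le> \<bar>d (M (sgn (z n)))\<bar>"
    using that not_le by blast
  then obtain d Ms where dM: "\<And>n. d n \<in> F" "\<And>n. Ms n \<in> \<M>"
      "\<And>n. e \<le> \<bar>blinfun_apply (d n) (blinfun_apply (Ms n) (sgn (z n)))\<bar>"
    by metis
  have bound: "norm (z n) \<le> inverse e * (\<Sum>f\<in>F. \<bar>blinfun_apply f (Ms n (z n))\<bar>)" for n
  proof -
    have "z n = norm (z n) *\<^sub>R sgn (z n)" by (cases "z n = 0") (simp_all add: sgn_div_norm)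
    then have "\<bar>d n (Ms n (z n))\<bar> = norm (z n) * \<bar>d n (Ms n (sgn (z n)))\<bar>"
      by (metis abs_mult abs_norm_cancel blinfun.scaleR_right real_scaleR_def)
    then have "norm (z n) * e \<le> \<bar>d n (Ms n (z n))\<bar>"
      using dM(3)[of n] by (simp add: mult_left_mono)
    also have "\<dots> \<le> (\<Sum>f\<in>F. \<bar>blinfun_apply f (Ms n (z n))\<bar>)"
      using F dM(1) by (intro member_le_sum) auto
    finally show ?thesis using e by (simp add: field_simps)
  qed
  have "summable (\<lambda>n. \<bar>blinfun_apply f (Ms n (z n))\<bar>)" for f :: "'x \<Rightarrow>\<^sub>L real"
    using wuC[of Ms, OF dM(2)] unfolding weakly_unconditionally_Cauchy_def by blast
  then have "summable (\<lambda>n. inverse e * (\<Sum>f\<in>F. \<bar>blinfun_apply f (Ms n (z n))\<bar>))"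
    by (intro summable_mult summable_sum) auto
  then have "summable (\<lambda>n. norm (z n))"
    by (rule summable_comparison_test'[where N = 0]) (use bound in auto)
  then show False using not_summable by contradiction
qed

theorem theorem1p3:
  fixes \<M> :: "('z::banach \<Rightarrow>\<^sub>L 'x::banach) set"
    and z :: "nat \<Rightarrow> 'z"
    and T :: "'z \<Rightarrow>\<^sub>L 'x"
  assumes "Asplund_space TYPE('x)"
    and "bounded \<M>"
    and "Rainwater_property \<M>"
    and "\<And>n. compact (closure {blinfun_apply M (z n) | M. M \<in> \<M>})"
    and "\<And>Ms :: nat \<Rightarrow> ('z \<Rightarrow>\<^sub>L 'x). (\<And>n. Ms n \<in> \<M>) \<Longrightarrow>
           weakly_unconditionally_Cauchy (\<lambda>n. blinfun_apply (Ms n) (z n))"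
    and "T \<in> \<M>"
    and "Dunford_Pettis T"
    and "\<And>n. z n \<noteq> 0"
    and "(INF n. norm (blinfun_apply T (z n)) / norm (z n)) > 0"
  shows "summable (\<lambda>n. norm (blinfun_apply T (z n)))"
proof -
  define W where "W n = {blinfun_apply M (z n) | M. M \<in> \<M>}" for n
  have "\<exists>C. countable C \<and> W n \<subseteq> closure C" for n
  proof -
    have "compact (closure (W n))" unfolding W_def by (rule assms(4))
    then obtain C where C: "countable C" "closure (W n) \<subseteq> closure C"
      using compact_imp_countable_dense_subset by metis
    have "W n \<subseteq> closure C" using closure_subset C(2) by (rule subset_trans)
    then show ?thesis using C(1) by blast
  qed
  then obtain C where C: "\<And>n. countable (C n)" "\<And>n. W n \<subseteq> closure (C n)"
    by metis
  define S where "S = (\<Union>n. C n)"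
  have "countable S" unfolding S_def using C(1) by simp
  then obtain d :: "nat \<Rightarrow> 'x \<Rightarrow>\<^sub>L real" where
    d: "\<And>(f :: 'x \<Rightarrow>\<^sub>L real) e. e > 0 \<Longrightarrow> \<exists>i. \<forall>y\<in>closure S. \<bar>f y - d i y\<bar> \<le> e * norm y"
    using Asplund_countable_functionals[OF assms(1), of S] by blast
  have in_S: "M (z n) \<in> closure S" if "M \<in> \<M>" for M n
  proof -
    have "M (z n) \<in> W n" using that unfolding W_def by blast
    moreover have "closure (C n) \<subseteq> closure S" unfolding S_def by (intro closure_mono) blast
    ultimately show ?thesis using C(2) by blast
  qed

  have "summable (\<lambda>n. norm (z n))"
  proof (rule ccontr)
    assume not_summable: "\<not> summable (\<lambda>n. norm (z n))"
    \<comment> \<open>The chosen indices may repeat: weak nullity of the diagonal sequence needs only the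
      decreasing bounds.\<close>
    have "\<exists>n. \<forall>i\<le>k. \<forall>M\<in>\<M>. \<bar>d i (M (sgn (z n)))\<bar> < inverse (real (Suc k))" for k
      by (rule uniformly_small_normalized_term
          [OF assms(5) not_summable, where F = "d ` {..k}" and e = "inverse (real (Suc k))"]) auto
    then obtain r where r: "\<And>k i M. i \<le> k \<Longrightarrow> M \<in> \<M> \<Longrightarrow>
        \<bar>d i (M (sgn (z (r k))))\<bar> < inverse (real (Suc k))"
      by metis
    define u where "u k = sgn (z (r k))" for k
    have norm_u: "norm (u k) = 1" for k
      using assms(8) by (simp add: u_def norm_sgn)
    have "weakly_null (\<lambda>k. M (u k))" if M: "M \<in> \<M>" for M
      unfolding weakly_null_def
    proof
      fix f :: "'x \<Rightarrow>\<^sub>L real"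
      show "(\<lambda>k. f (M (u k))) \<longlonglongrightarrow> 0"
      proof (rule LIMSEQ_I)
        fix e :: real assume e: "e > 0"
        define e' where "e' = e / (2 * (norm M + 1))"
        have pos: "norm M + 1 > 0" by (simp add: add_nonneg_pos)
        have e': "e' > 0" "e' * norm M < e / 2"
          unfolding e'_def using e pos by (auto simp: field_simps)
        obtain i where i: "\<And>y. y \<in> closure S \<Longrightarrow> \<bar>f y - d i y\<bar> \<le> e' * norm y"
          using d[OF e'(1), of f] by blast
        obtain j where j: "inverse (real (Suc j)) < e / 2"
          using reals_Archimedean[of "e / 2"] e by auto
        have "\<bar>f (M (u k))\<bar> < e" if k: "k \<ge> max i j" for k
        proof -
          have "u k = inverse (norm (z (r k))) *\<^sub>R z (r k)"
            by (simp add: u_def sgn_div_norm)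
          \<comment> \<open>The estimate on \<open>closure S\<close> is homogeneous, so it holds on its multiples.\<close>
          then have Mu: "M (u k) = inverse (norm (z (r k))) *\<^sub>R M (z (r k))"
            by (simp add: blinfun.scaleR_right)
          have "\<bar>f (M (u k)) - d i (M (u k))\<bar>
              = inverse (norm (z (r k))) * \<bar>f (M (z (r k))) - d i (M (z (r k)))\<bar>"
            unfolding Mu by (simp add: blinfun.scaleR_right abs_mult flip: right_diff_distrib)
          also have "\<dots> \<le> inverse (norm (z (r k))) * (e' * norm (M (z (r k))))"
            using i[OF in_S[OF M]] by (intro mult_left_mono) auto
          also have "\<dots> = e' * norm (M (u k))" unfolding Mu by simp
          also have "\<dots> \<le> e' * norm M"
            using norm_blinfun[of M "u k"] e'(1) norm_u[of k] by (intro mult_left_mono) auto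
          finally have "\<bar>f (M (u k)) - d i (M (u k))\<bar> < e / 2" using e'(2) by simp
          moreover have "\<bar>d i (M (u k))\<bar> < inverse (real (Suc k))"
            using r[of i k M] k M by (simp add: u_def)
          moreover have "inverse (real (Suc k)) \<le> inverse (real (Suc j))"
            using k by (intro le_imp_inverse_le) auto
          ultimately show ?thesis using j by linarith
        qed
        then show "\<exists>N. \<forall>k\<ge>N. norm (f (M (u k)) - 0) < e"
          by (intro exI[of _ "max i j"]) simp
      qed
    qed
    moreover have "bounded (range u)"
      using norm_u by (auto simp: bounded_iff intro!: exI[of _ 1])
    ultimately have "weakly_null u"
      using assms(3) unfolding Rainwater_property_def by blast
    then have "(\<lambda>k. T (u k)) \<longlonglongrightarrow> 0"
      using assms(7) unfolding Dunford_Pettis_def by blast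
    then have Tu: "(\<lambda>k. norm (T (u k))) \<longlonglongrightarrow> 0" by (rule tendsto_norm_zero)
    define c where "c = (INF n. norm (T (z n)) / norm (z n))"
    have "c \<le> norm (T (u k))" for k
    proof -
      have "c \<le> norm (T (z (r k))) / norm (z (r k))"
        unfolding c_def by (intro cINF_lower bdd_belowI2[where m = 0]) auto
      also have "\<dots> = norm (T (u k))"
        by (simp add: u_def sgn_div_norm blinfun.scaleR_right field_simps)
      finally show ?thesis .
    qed
    then have "c \<le> 0" by (intro LIMSEQ_le_const[OF Tu]) auto
    then show False using assms(9) c_def by simp
  qed
  then have "summable (\<lambda>n. norm T * norm (z n))" by (rule summable_mult)
  then show ?thesis
    by (rule summable_comparison_test'[where N = 0]) (use norm_blinfun in auto)
qed

end
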